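(* Let $n \ge 2$, $s \ge 2$, and let $\mathcal{D}_{n,s} \subset \mathbb{R}^n$ be a positive basis of $\mathbb{R}^n$ of size $n+s$. Then $\mathcal{D}_{n,s}$ is an orthogonally structured positive basis if and only if one of its Gram matrices can be written as a block diagonal matrix with $s$ diagonal blocks.
   Context: Families of vectors may contain repetitions; positive spanning sets are finite families of nonzero vectors. For a linear subspace $\mathbb{L}$ of $\mathbb{R}^n$ and a finite family $\mathcal{D}$ in $\mathbb{L}$, the positive span $\mathrm{pspan}(\mathcal{D})$ is the set of all linear combinations of elements of $\mathcal{D}$ with nonnegative coefficients; $\mathcal{D}$ is a positive spanning set of $\mathbb{L}$ if $\mathrm{pspan}(\mathcal{D})=\mathbb{L}$. A positive basis of $\mathbb{L}$ is a positive spanning set $\mathcal{D}$ of $\mathbb{L}$ such that $\mathrm{pspan}(\mathcal{D}\setminus\{\mathbf{d}\})\neq\mathbb{L}$ for every $\mathbf{d}\in\mathcal{D}$ (where $\mathcal{D}\setminus\{\mathbf{d}\}$ removes exactly one instance of $\mathbf{d}$). A positive basis of $\mathbb{L}$ is called minimal if it has exactly $\dim(\mathbb{L})+1$ elements (with $\dim \mathbb{L}\ge 1$). A positive basis $\mathcal{D}_{n,s}$ of $\mathbb{R}^n$ with $n+s$ elements is an orthogonally structured positive basis (OSPB) if there exist pairwise orthogonal subspaces $\mathbb{L}_1,\dots,\mathbb{L}_s$ of $\mathbb{R}^n$ with $\mathbb{R}^n=\mathbb{L}_1+\cdots+\mathbb{L}_s$ and minimal positive bases $\mathcal{D}_{\mathbb{L}_i}$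 of $\mathbb{L}_i$ ($i=1,\dots,s$) such that $\mathcal{D}_{n,s}=\mathcal{D}_{\mathbb{L}_1}\cup\cdots\cup\mathcal{D}_{\mathbb{L}_s}$. A matrix representation of a finite family $\mathcal{S}$ of $m$ vectors in $\mathbb{R}^n$ is a matrix $\mathbf{S}\in\mathbb{R}^{n\times m}$ whose columns are the elements of $\mathcal{S}$, in any order. A Gram matrix of $\mathcal{S}$ is a matrix $\mathbf{G}(\mathbf{S})=\mathbf{S}^\top\mathbf{S}$ where $\mathbf{S}$ is a matrix representation of $\mathcal{S}$. *)

theory Defs
  imports "Jordan_Normal_Form.VS_Connect" "HOL-Library.Multiset"
begin

text \<open>
  The space \<open>\<real>\<^sup>n\<close> is the vector space of real vectors of dimension \<open>n\<close>, with underlying set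
  \<^term>\<open>carrier_vec n :: real vec set\<close>. A finite family of vectors (repetitions allowed, order
  irrelevant) is a multiset, so \<open>D - {#d#}\<close> removes exactly one instance of \<open>d\<close>.
\<close>

abbreviation Rn :: "nat \<Rightarrow> (real, real vec) module" where
  "Rn n \<equiv> module_vec TYPE(real) n"

abbreviation linear_subspace :: "nat \<Rightarrow> real vec set \<Rightarrow> bool" where
  "linear_subspace n L \<equiv> VectorSpace.subspace class_ring L (Rn n)"

abbreviation subspace_dim :: "nat \<Rightarrow> real vec set \<Rightarrow> nat" where
  "subspace_dim n L \<equiv> vectorspace.dim class_ring ((Rn n)\<lparr>carrier := L\<rparr>)"

text \<open>
  The coefficients are attached to the distinct members of \<open>D\<close>: the coefficients of repeated
  instances of a vector add up to a single nonnegative one.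
\<close>

definition pspan :: "nat \<Rightarrow> real vec multiset \<Rightarrow> real vec set" where
  "pspan n D = {module.lincomb (Rn n) c (set_mset D) | c. \<forall>d\<in>#D. 0 \<le> c d}"

definition positive_spanning_set :: "nat \<Rightarrow> real vec set \<Rightarrow> real vec multiset \<Rightarrow> bool" where
  "positive_spanning_set n L D \<longleftrightarrow>
     linear_subspace n L \<and> set_mset D \<subseteq> L \<and> 0\<^sub>v n \<notin># D \<and> pspan n D = L"

definition positive_basis :: "nat \<Rightarrow> real vec set \<Rightarrow> real vec multiset \<Rightarrow> bool" where
  "positive_basis n L D \<longleftrightarrow>
     positive_spanning_set n L D \<and> (\<forall>d\<in>#D. pspan n (D - {#d#}) \<noteq> L)"

definition minimal_positive_basis :: "nat \<Rightarrow> real vec set \<Rightarrow> real vec multiset \<Rightarrow> bool" where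
  "minimal_positive_basis n L D \<longleftrightarrow>
     positive_basis n L D \<and> 1 \<le> subspace_dim n L \<and> size D = subspace_dim n L + 1"

text \<open>
  The subspaces are indexed by \<open>{..<s}\<close>. The union of the families \<open>DL i\<close> is their multiset sum,
  so that instances are counted; the families have no common member, since their members are
  nonzero and lie in pairwise orthogonal subspaces.
\<close>

definition ospb :: "nat \<Rightarrow> nat \<Rightarrow> real vec multiset \<Rightarrow> bool" where
  "ospb n s D \<longleftrightarrow>
     positive_basis n (carrier_vec n) D \<and> size D = n + s \<and>
     (\<exists>L DL.
        (\<forall>i<s. linear_subspace n (L i)) \<and>
        (\<forall>i<s. \<forall>j<s. i \<noteq> j \<longrightarrow> (\<forall>x\<in>L i. \<forall>y\<in>L j. x \<bullet> y = 0)) \<and>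
        carrier_vec n = {finsum_vec TYPE(real) n v {..<s} | v. \<forall>i<s. v i \<in> L i} \<and>
        (\<forall>i<s. minimal_positive_basis n (L i) (DL i)) \<and>
        D = (\<Sum>i<s. DL i))"

definition matrix_representation :: "nat \<Rightarrow> real vec multiset \<Rightarrow> real mat \<Rightarrow> bool" where
  "matrix_representation n D S \<longleftrightarrow> S \<in> carrier_mat n (size D) \<and> mset (cols S) = D"

definition gram_matrix :: "nat \<Rightarrow> real vec multiset \<Rightarrow> real mat \<Rightarrow> bool" where
  "gram_matrix n D G \<longleftrightarrow> (\<exists>S. matrix_representation n D S \<and> G = transpose_mat S * S)"

text \<open>
  Diagonal blocks are square of size at least 1. With empty blocks allowed, every square matrix
  would have any positive number of diagonal blocks.
\<close>

definition block_diagonal :: "nat \<Rightarrow> real mat \<Rightarrow> bool" where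
  "block_diagonal s G \<longleftrightarrow>
     (\<exists>Bs. length Bs = s \<and> (\<forall>B\<in>set Bs. square_mat B \<and> 0 < dim_row B) \<and> G = diag_block_mat Bs)"

end

theory Submission
  imports Defs
begin

text \<open>
  A Gram matrix of \<open>D\<close> records the pairwise scalar products of an enumeration of \<open>D\<close>, so
  cutting it into \<open>s\<close> diagonal blocks with zeros elsewhere is the same as partitioning \<open>D\<close>
  into \<open>s\<close> nonempty subfamilies that are orthogonal to each other
  (\<open>block_diagonal_gram_matrix_iff\<close>). An orthogonally structured positive basis visibly has
  such a partition, given by the minimal positive bases of its subspaces.

  Conversely, let \<open>D\<close> be the sum of pairwise orthogonal nonempty families \<open>F i\<close>, and let
  \<open>L i\<close> be the linear span of \<open>F i\<close>. These spans are again pairwise orthogonal. If a vector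
  \<open>v\<close> of \<open>L i\<close> is written as a nonnegative combination of \<open>D\<close>, the part of the combination
  contributed by the other families lies in \<open>L i\<close> and is orthogonal to \<open>L i\<close>, hence vanishes.
  So \<open>F i\<close> positively spans \<open>L i\<close>, and it does so without redundancy because a redundant
  member of \<open>F i\<close> would be redundant in \<open>D\<close>: each \<open>F i\<close> is a positive basis of \<open>L i\<close>
  (\<open>positive_basis_orthogonal_summand\<close>).

  Minimality comes from counting. A nonempty positive spanning set of \<open>L\<close> has at least
  \<open>dim L + 1\<close> members (\<open>subspace_dim_less_size\<close>), while the dimensions of the \<open>L i\<close> add up to
  at least \<open>n\<close> (\<open>le_sum_subspace_dim\<close>). As the families have \<open>n + s\<close> members altogether, none
  of the \<open>s\<close> lower bounds on their sizes can be strict.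
\<close>

section \<open>Positive spans of sums of families\<close>

context
  fixes n :: nat
begin

interpretation vec_space "TYPE(real)" n .

lemma lincomb_extend_zero:
  assumes "finite B" "A \<subseteq> B" "B \<subseteq> carrier_vec n"
  shows "lincomb c A = lincomb (\<lambda>v. if v \<in> A then c v else 0) B"
proof -
  let ?c = "\<lambda>v. if v \<in> A then c v else 0"
  have "lincomb ?c B = lincomb ?c (A \<union> (B - A))"
    using assms(2) by (simp add: Un_absorb1)
  also have "\<dots> = lincomb ?c A"
    by (rule lincomb_clean) (use assms in \<open>auto intro: finite_subset\<close>)
  also have "\<dots> = lincomb c A"
    unfolding lincomb_def by (rule finsum_cong') (use assms in auto)
  finally show ?thesis ..
qed

text \<open>
  The two families may share vectors, and coefficients are attached to distinct vectors. In one
  direction the coefficient of a shared vector is given entirely to \<open>A\<close>; in the other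
  direction the two coefficients of a shared vector are added.
\<close>

lemma pspan_plus:
  assumes "set_mset A \<subseteq> carrier_vec n" "set_mset B \<subseteq> carrier_vec n"
  shows "pspan n (A + B) = {a + b | a b. a \<in> pspan n A \<and> b \<in> pspan n B}" (is "?L = ?R")
proof (intro subset_antisym subsetI)
  fix x assume "x \<in> ?L"
  then obtain c where c: "x = lincomb c (set_mset A \<union> set_mset B)" "\<forall>d\<in>set_mset A \<union> set_mset B. 0 \<le> c d"
    unfolding pspan_def by auto
  let ?b = "\<lambda>v. if v \<in> set_mset B - set_mset A then c v else 0"
  have "x = lincomb c (set_mset A \<union> (set_mset B - set_mset A))"
    using c(1) by simp
  also have "\<dots> = lincomb c (set_mset A) + lincomb c (set_mset B - set_mset A)"
    by (rule lincomb_union) (use assms in auto)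
  also have "lincomb c (set_mset B - set_mset A) = lincomb ?b (set_mset B)"
    by (rule lincomb_extend_zero) (use assms in auto)
  finally have "x = lincomb c (set_mset A) + lincomb ?b (set_mset B)" .
  moreover have "lincomb c (set_mset A) \<in> pspan n A" "lincomb ?b (set_mset B) \<in> pspan n B"
    unfolding pspan_def using c(2) by (fastforce intro: exI[of _ c] exI[of _ ?b])+
  ultimately show "x \<in> ?R" by blast
next
  fix x assume "x \<in> ?R"
  then obtain a b where x: "x = lincomb a (set_mset A) + lincomb b (set_mset B)"
    and ab: "\<forall>d\<in>#A. 0 \<le> a d" "\<forall>d\<in>#B. 0 \<le> b d"
    unfolding pspan_def by blast
  let ?U = "set_mset A \<union> set_mset B"
  let ?a = "\<lambda>v. if v \<in> set_mset A then a v else 0"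
  let ?b = "\<lambda>v. if v \<in> set_mset B then b v else 0"
  have "x = lincomb ?a ?U + lincomb ?b ?U"
    unfolding x using lincomb_extend_zero[of ?U "set_mset A" a] lincomb_extend_zero[of ?U "set_mset B" b] assms
    by simp
  also have "\<dots> = lincomb (\<lambda>v. ?a v + ?b v) ?U"
    by (rule lincomb_sum[symmetric]) (use assms in auto)
  finally show "x \<in> ?L"
    unfolding pspan_def using ab by (auto intro!: exI[of _ "\<lambda>v. ?a v + ?b v"])
qed

lemma pspan_subset_span: "pspan n D \<subseteq> span (set_mset D)"
  unfolding pspan_def span_def by auto

lemma pspan_sum:
  fixes s :: nat
  assumes "\<And>i. i < s \<Longrightarrow> set_mset (F i) \<subseteq> carrier_vec n"
  shows "pspan n (\<Sum>i<s. F i) = {finsum_vec TYPE(real) n v {..<s} | v. \<forall>i<s. v i \<in> pspan n (F i)}"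
  using assms
proof (induction s)
  case 0
  then show ?case by (auto simp: pspan_def)
next
  case (Suc s)
  have mem: "x \<in> carrier_vec n" if "x \<in> pspan n (F i)" "i < Suc s" for i x
    using that pspan_subset_span[of "F i"] Suc.prems[of i] span_is_subset2[of "set_mset (F i)"] by auto
  have ins: "finsum V v {..<Suc s} = v s + finsum V v {..<s}" if "\<forall>i<Suc s. v i \<in> pspan n (F i)" for v
    unfolding lessThan_Suc by (rule finsum_insert) (use that mem in \<open>auto simp: less_Suc_eq\<close>)
  have "pspan n (\<Sum>i<Suc s. F i)
      = {a + b | a b. a \<in> pspan n (F s) \<and> b \<in> pspan n (\<Sum>i<s. F i)}"
    using pspan_plus[of "F s" "\<Sum>i<s. F i"] Suc.prems
    by (auto simp: add.commute set_mset_sum less_Suc_eq subset_iff)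
  also have "\<dots> = {a + finsum V v {..<s} | a v. a \<in> pspan n (F s) \<and> (\<forall>i<s. v i \<in> pspan n (F i))}"
    using Suc by auto
  also have "\<dots> = {finsum V v {..<Suc s} | v. \<forall>i<Suc s. v i \<in> pspan n (F i)}" (is "?L = ?R")
  proof (intro subset_antisym subsetI)
    fix x assume "x \<in> ?L"
    then obtain a v where x: "x = a + finsum V v {..<s}" and a: "a \<in> pspan n (F s)"
      and v: "\<forall>i<s. v i \<in> pspan n (F i)" by blast
    have "finsum V (v(s := a)) {..<s} = finsum V v {..<s}"
      by (rule finsum_cong') (use v mem in auto)
    then show "x \<in> ?R"
      using ins[of "v(s := a)"] x a v by (auto intro!: exI[of _ "v(s := a)"] simp: less_Suc_eq)
  next
    fix x assume "x \<in> ?R"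
    then obtain v where "x = finsum V v {..<Suc s}" and v: "\<forall>i<Suc s. v i \<in> pspan n (F i)" by blast
    then have "x = v s + finsum V v {..<s}" using ins by blast
    then show "x \<in> ?L" using v by (auto intro!: exI[of _ "v s"] exI[of _ v])
  qed
  finally show ?case by simp
qed

section \<open>Orthogonal summands of a positive basis\<close>

definition orthogonal_sets :: "real vec set \<Rightarrow> real vec set \<Rightarrow> bool" where
  "orthogonal_sets A B \<longleftrightarrow> (\<forall>x\<in>A. \<forall>y\<in>B. x \<bullet> y = 0)"

lemma orthogonal_span:
  assumes "A \<subseteq> carrier_vec n" "B \<subseteq> carrier_vec n" "orthogonal_sets A B"
  shows "orthogonal_sets (span A) (span B)"
proof -
  have left: "x \<bullet> y = 0"
    if "C \<subseteq> carrier_vec n" "y \<in> carrier_vec n" "\<And>c. c \<in> C \<Longrightarrow> c \<bullet> y = 0" "x \<in> span C" for C x y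
  proof -
    from that(4) obtain a S where S: "x = lincomb a S" "finite S" "S \<subseteq> C"
      unfolding span_def by auto
    have "x \<bullet> y = (\<Sum>u\<in>S. (a u \<cdot>\<^sub>v u) \<bullet> y)"
      unfolding S(1) lincomb_def by (rule finsum_scalar_prod_sum) (use S that in auto)
    also have "\<dots> = 0"
    proof (rule sum.neutral, intro ballI)
      fix u assume "u \<in> S"
      then have "u \<in> carrier_vec n" "u \<bullet> y = 0" using S that by auto
      then show "(a u \<cdot>\<^sub>v u) \<bullet> y = 0" using smult_scalar_prod_distrib[of u n y "a u"] that(2) by simp
    qed
    finally show ?thesis .
  qed
  have "x \<bullet> y = 0" if "x \<in> A" "y \<in> span B" for x y
  proof -
    have xc: "x \<in> carrier_vec n" using that assms by auto
    have "c \<bullet> x = 0" if "c \<in> B" for c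
      using that assms \<open>x \<in> A\<close> xc comm_scalar_prod[of c n x] by (auto simp: orthogonal_sets_def)
    then have "y \<bullet> x = 0"
      using left[OF assms(2) xc _ \<open>y \<in> span B\<close>] by blast
    then show ?thesis using that assms span_is_subset2[OF assms(2)] comm_scalar_prod[of x n y] by auto
  qed
  then show ?thesis
    unfolding orthogonal_sets_def using left[OF assms(1)] span_is_subset2[OF assms(2)] by auto
qed

lemma self_orthogonal_eq_zero:
  assumes "(x :: real vec) \<in> carrier_vec n" "x \<bullet> x = 0"
  shows "x = 0\<^sub>v n"
proof (rule eq_vecI)
  show "dim_vec x = dim_vec (0\<^sub>v n)" using assms by simp
  fix i assume "i < dim_vec (0\<^sub>v n :: real vec)"
  then show "x $ i = 0\<^sub>v n $ i"
    using assms by (auto simp: scalar_prod_def sum_nonneg_eq_0_iff)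
qed

lemma pspan_closed: "set_mset D \<subseteq> carrier_vec n \<Longrightarrow> pspan n D \<subseteq> carrier_vec n"
  using pspan_subset_span span_is_subset2[of "set_mset D"] by auto

text \<open>
  If \<open>v\<close> lies in the span of \<open>A\<close> and \<open>v = a + b\<close> with \<open>a\<close> and \<open>b\<close> in the positive spans of
  \<open>A\<close> and \<open>B\<close>, then \<open>b = v - a\<close> lies in both linear spans and is therefore orthogonal to
  itself. Hence the positive span of \<open>A\<close> is already its linear span. Redundancy of a member in
  \<open>A\<close> would pass to \<open>A + B\<close>, whose positive span depends only on those of the summands.
\<close>

lemma positive_basis_orthogonal_summand:
  assumes pb: "positive_basis n (carrier_vec n) (A + B)"
    and orth: "orthogonal_sets (set_mset A) (set_mset B)"
  shows "positive_basis n (span (set_mset A)) A"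
proof -
  have A: "set_mset A \<subseteq> carrier_vec n" and B: "set_mset B \<subseteq> carrier_vec n"
    and nz: "0\<^sub>v n \<notin># A" and all: "pspan n (A + B) = carrier_vec n"
    using pb by (auto simp: positive_basis_def positive_spanning_set_def)
  have pspan_A: "pspan n A = span (set_mset A)"
  proof (intro subset_antisym pspan_subset_span subsetI)
    fix v assume v: "v \<in> span (set_mset A)"
    then have vc: "v \<in> carrier_vec n" using A by simp
    then obtain a b where ab: "v = a + b" "a \<in> pspan n A" "b \<in> pspan n B"
      using all pspan_plus[OF A B] by blast
    have c: "a \<in> carrier_vec n" "b \<in> carrier_vec n"
      using ab pspan_closed[OF A] pspan_closed[OF B] by auto
    have aA: "a \<in> span (set_mset A)" and bB: "b \<in> span (set_mset B)"
      using ab pspan_subset_span by auto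
    have bA: "b \<in> span (set_mset A)"
      using span_add[OF A aA c(2)] v ab(1) by simp
    then have "b \<bullet> b = 0"
      using orthogonal_span[OF A B orth] bB by (auto simp: orthogonal_sets_def)
    then have "b = 0\<^sub>v n" using self_orthogonal_eq_zero c by blast
    then show "v \<in> pspan n A" using ab c by simp
  qed
  have "pspan n (A - {#d#}) \<noteq> span (set_mset A)" if d: "d \<in># A" for d
  proof
    assume eq: "pspan n (A - {#d#}) = span (set_mset A)"
    have "set_mset (A - {#d#}) \<subseteq> carrier_vec n" using A by (auto dest: in_diffD)
    then have "pspan n ((A - {#d#}) + B) = pspan n (A + B)"
      using eq pspan_A pspan_plus[OF _ B] A by simp
    moreover have "(A - {#d#}) + B = (A + B) - {#d#}" using d by simp
    ultimately show False
      using pb all d by (auto simp: positive_basis_def)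
  qed
  then show ?thesis
    using A nz pspan_A span_is_subspace[of "set_mset A"] in_own_span[of "set_mset A"]
    by (auto simp: positive_basis_def positive_spanning_set_def)
qed

section \<open>Dimension and the size of positive spanning sets\<close>

text \<open>
  The dimension of \<open>L\<close> is defined inside \<open>L\<close> viewed as a vector space of its own; this
  expresses it through spans taken in the ambient space.
\<close>

lemma subspace_dim_eq_Least:
  assumes "linear_subspace n L"
  shows "subspace_dim n L = (LEAST m. \<exists>A. finite A \<and> card A = m \<and> A \<subseteq> L \<and> span A = L)"
proof -
  have sm: "submodule class_ring L V" using assms by (simp add: subspace_def VectorSpace.subspace_def)
  have vs: "vectorspace class_ring (V\<lparr>carrier := L\<rparr>)" using assms by (rule subspace_is_vs)
  show ?thesis
    unfolding vectorspace.dim_def[OF vs]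
    by (simp add: span_li_not_depend(1)[OF _ sm] cong: conj_cong)
qed

lemma subspace_dim_le_card:
  assumes "linear_subspace n L" "finite A" "A \<subseteq> L" "span A = L"
  shows "subspace_dim n L \<le> card A"
  unfolding subspace_dim_eq_Least[OF assms(1)] by (rule Least_le) (use assms in auto)

lemma subspace_dim_spanning_set:
  assumes "linear_subspace n L" "finite A" "A \<subseteq> L" "span A = L"
  obtains C where "finite C" "C \<subseteq> L" "span C = L" "card C = subspace_dim n L"
  using LeastI_ex[of "\<lambda>m. \<exists>C. finite C \<and> card C = m \<and> C \<subseteq> L \<and> span C = L"] assms
  unfolding subspace_dim_eq_Least[OF assms(1)] by blast

lemma positive_spanning_set_span:
  assumes "positive_spanning_set n L D"
  shows "span (set_mset D) = L" "L \<subseteq> carrier_vec n"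
proof -
  have sm: "submodule class_ring L V" and D: "set_mset D \<subseteq> L" "pspan n D = L"
    using assms by (auto simp: positive_spanning_set_def VectorSpace.subspace_def)
  show "span (set_mset D) = L"
    using span_is_subset[OF D(1) sm] pspan_subset_span[of D] D(2) by auto
  show "L \<subseteq> carrier_vec n" using sm by (auto simp: submodule_def)
qed

text \<open>
  For a member \<open>d\<close>, the vector \<open>- d\<close> is a nonnegative combination of \<open>D\<close>. If \<open>d\<close> itself
  occurs there with coefficient \<open>c \<ge> 0\<close>, then \<open>- (1 + c) d\<close> is a combination of the remaining
  vectors, and \<open>1 + c\<close> is nonzero. So all instances of \<open>d\<close> can be dropped from \<open>D\<close> without
  changing its linear span, which leaves a generating set with fewer than \<open>size D\<close> elements.
\<close>

lemma subspace_dim_less_size: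
  assumes pss: "positive_spanning_set n L D" and ne: "D \<noteq> {#}"
  shows "subspace_dim n L < size D"
proof -
  note span_D = positive_spanning_set_span[OF pss]
  have sub: "linear_subspace n L" and sm: "submodule class_ring L V"
    and DL: "set_mset D \<subseteq> L" and pD: "pspan n D = L"
    using pss by (auto simp: positive_spanning_set_def VectorSpace.subspace_def)
  from ne obtain d where d: "d \<in># D" by auto
  let ?E = "set_mset D - {d}"
  have Ec: "?E \<subseteq> carrier_vec n" and dc: "d \<in> carrier_vec n" using DL span_D(2) d by auto
  have "- 1 \<cdot>\<^sub>v d \<in> L" using sm DL d submodule.smult_closed[OF sm, of "-1" d] by auto
  then obtain c where c: "- 1 \<cdot>\<^sub>v d = lincomb c (set_mset D)" "\<forall>e\<in>#D. 0 \<le> c e"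
    using pD unfolding pspan_def by blast
  have "set_mset D = insert d ?E" using d by auto
  then have "- 1 \<cdot>\<^sub>v d = c d \<cdot>\<^sub>v d + lincomb c ?E"
    using lincomb_insert2[of ?E c d] c(1) Ec dc by auto
  moreover have lc: "lincomb c ?E \<in> carrier_vec n" using Ec by simp
  ultimately have "\<forall>i<n. - (d $ i) = c d * d $ i + lincomb c ?E $ i"
    using dc by (metis carrier_vecD index_add_vec(1) index_smult_vec(1) mult_minus1)
  then have "\<forall>i<n. (1 + c d) * d $ i = - lincomb c ?E $ i" by (auto simp: algebra_simps)
  moreover have "0 < 1 + c d" using c(2) d by (simp add: add_pos_nonneg)
  ultimately have "d = (- 1 / (1 + c d)) \<cdot>\<^sub>v lincomb c ?E"
    using dc lc by (intro eq_vecI) (auto simp: field_simps)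
  moreover have "lincomb c ?E \<in> span ?E" unfolding span_def by auto
  ultimately have "d \<in> span ?E" using smult_in_span[OF Ec] by metis
  then have "span ?E = span (set_mset D)"
    using already_in_span[OF Ec] d by (metis Un_insert_right insert_Diff sup_bot_right)
  then have "subspace_dim n L \<le> card ?E"
    using subspace_dim_le_card[OF sub, of ?E] DL span_D by auto
  also have "\<dots> < card (set_mset D)" using card_Diff1_less[OF _ d] by simp
  also have "\<dots> \<le> size D" by (metis card_length ex_mset set_mset_mset size_mset)
  finally show ?thesis .
qed

text \<open>
  Generating sets of the \<open>L i\<close> of smallest size together generate the whole space. Only this
  inequality is true in general; for orthogonal \<open>L i\<close> it becomes an equality.
\<close>

lemma le_sum_subspace_dim:
  fixes s :: nat
  assumes pss: "\<And>i. i < s \<Longrightarrow> positive_spanning_set n (L i) (F i)"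
    and all: "span (\<Union>i<s. set_mset (F i)) = carrier_vec n"
  shows "n \<le> (\<Sum>i<s. subspace_dim n (L i))"
proof -
  define good where "good i C \<longleftrightarrow> finite C \<and> C \<subseteq> L i \<and> span C = L i
    \<and> card C = subspace_dim n (L i)" for i C
  have "\<exists>C. good i C" if "i \<in> {..<s}" for i
  proof (rule subspace_dim_spanning_set)
    show "linear_subspace n (L i)" "set_mset (F i) \<subseteq> L i"
      using pss that by (simp_all add: positive_spanning_set_def)
    show "span (set_mset (F i)) = L i" using positive_spanning_set_span(1)[OF pss] that by simp
  qed (auto simp: good_def)
  then obtain C where "\<forall>i\<in>{..<s}. good i (C i)"
    using bchoice[of "{..<s}" good] by blast
  then have C: "finite (C i)" "C i \<subseteq> L i" "span (C i) = L i"
      "card (C i) = subspace_dim n (L i)" if "i < s" for i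
    using that by (simp_all add: good_def)
  let ?C = "\<Union>i<s. C i"
  have Cc: "?C \<subseteq> carrier_vec n"
    using C(2) positive_spanning_set_span(2)[OF pss] by fastforce
  have "set_mset (F i) \<subseteq> span ?C" if "i < s" for i
  proof -
    have "set_mset (F i) \<subseteq> span (C i)"
      using pss[OF that] C(3)[OF that] by (simp add: positive_spanning_set_def)
    also have "\<dots> \<subseteq> span ?C" by (rule span_is_monotone) (use that in auto)
    finally show ?thesis .
  qed
  then have "carrier_vec n \<subseteq> span ?C"
    using span_subsetI[OF Cc, of "\<Union>i<s. set_mset (F i)"] all by auto
  then have "span ?C = carrier_vec n" using span_is_subset2[of ?C] Cc by auto
  have "n \<le> card ?C"
  proof -
    have "finite ?C" using C(1) by auto
    then show ?thesis
      using gen_ge_dim[of ?C] Cc dim_is_n \<open>span ?C = carrier_vec n\<close> by simp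
  qed
  also have "\<dots> \<le> (\<Sum>i<s. card (C i))" by (rule card_UN_le) simp
  also have "\<dots> = (\<Sum>i<s. subspace_dim n (L i))" using C(4) by simp
  finally show ?thesis .
qed

lemma subspace_dim_pos:
  assumes pss: "positive_spanning_set n L D" and ne: "D \<noteq> {#}"
  shows "0 < subspace_dim n L"
proof (rule ccontr)
  have sub: "linear_subspace n L" using pss by (simp add: positive_spanning_set_def)
  assume "\<not> ?thesis"
  then obtain C where "finite C" "span C = L" "card C = 0"
    using subspace_dim_spanning_set[OF sub, of "set_mset D"] pss positive_spanning_set_span(1)[OF pss]
    by (auto simp: positive_spanning_set_def)
  then have "L = {0\<^sub>v n}" using span_empty by simp
  then show False using pss ne by (auto simp: positive_spanning_set_def)
qed

end

section \<open>Block diagonal Gram matrices\<close>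

definition gram_of :: "real vec list \<Rightarrow> real mat" where
  "gram_of xs = mat (length xs) (length xs) (\<lambda>(i, j). xs ! i \<bullet> xs ! j)"

lemma dim_gram_of [simp]: "dim_row (gram_of xs) = length xs" "dim_col (gram_of xs) = length xs"
  by (simp_all add: gram_of_def)

lemma gram_of_append:
  assumes "set (xs @ ys) \<subseteq> carrier_vec n" "orthogonal_sets (set xs) (set ys)"
  shows "gram_of (xs @ ys) = four_block_mat (gram_of xs) (0\<^sub>m (length xs) (length ys))
           (0\<^sub>m (length ys) (length xs)) (gram_of ys)"
proof -
  have "x \<bullet> y = 0 \<and> y \<bullet> x = 0" if "x \<in> set xs" "y \<in> set ys" for x y
    using that assms comm_scalar_prod[of x n y] by (auto simp: orthogonal_sets_def)
  then show ?thesis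
    by (intro eq_matI) (auto simp: gram_of_def nth_append)
qed

lemma gram_of_concat:
  assumes "set (concat xss) \<subseteq> carrier_vec n"
    and "sorted_wrt (\<lambda>xs ys. orthogonal_sets (set xs) (set ys)) xss"
  shows "gram_of (concat xss) = diag_block_mat (map gram_of xss)"
  using assms
proof (induction xss)
  case Nil
  then show ?case by (auto simp: gram_of_def)
next
  case (Cons xs xss)
  have "orthogonal_sets (set xs) (set (concat xss))"
    using Cons.prems by (auto simp: orthogonal_sets_def)
  moreover have IH: "diag_block_mat (map gram_of xss) = gram_of (concat xss)"
    using Cons by simp
  ultimately show ?case
    using gram_of_append[of xs "concat xss" n] Cons.prems by (simp add: Let_def IH)
qed

text \<open>
  The sizes of the blocks prescribe where to cut \<open>xs\<close>, and the zero blocks say that each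
  piece is orthogonal to everything after it.
\<close>

lemma gram_of_eq_diag_block_mat:
  assumes "gram_of xs = diag_block_mat Bs" "\<forall>B\<in>set Bs. square_mat B \<and> 0 < dim_row B"
  shows "\<exists>xss. xs = concat xss \<and> length xss = length Bs \<and> [] \<notin> set xss
    \<and> sorted_wrt (\<lambda>xs ys. orthogonal_sets (set xs) (set ys)) xss"
  using assms
proof (induction Bs arbitrary: xs)
  case Nil
  then have "length xs = 0" using dim_gram_of(1)[of xs] by simp
  then show ?case by simp
next
  case (Cons B Bs)
  let ?k = "dim_row B" and ?E = "diag_block_mat Bs"
  have sq: "dim_col B = ?k" "dim_col ?E = dim_row ?E"
    using Cons.prems(2) diag_block_mat_square[of Bs] by auto
  have G: "gram_of xs = four_block_mat B (0\<^sub>m ?k (dim_col ?E)) (0\<^sub>m (dim_row ?E) ?k) ?E"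
    using Cons.prems(1) sq by (simp add: Let_def)
  have len: "length xs = ?k + dim_row ?E"
    using arg_cong[OF G, of dim_row] by simp
  have entry: "xs ! i \<bullet> xs ! j = (if i < ?k then if j < ?k then B $$ (i, j) else 0
      else if j < ?k then 0 else ?E $$ (i - ?k, j - ?k))"
    if "i < length xs" "j < length xs" for i j
    using arg_cong[OF G, of "\<lambda>M. M $$ (i, j)"] that len sq by (auto simp: gram_of_def)
  have "gram_of (drop ?k xs) = ?E"
    by (rule eq_matI) (use len sq entry in \<open>auto simp: gram_of_def\<close>)
  then obtain xss where xss: "drop ?k xs = concat xss" "length xss = length Bs" "[] \<notin> set xss"
    "sorted_wrt (\<lambda>xs ys. orthogonal_sets (set xs) (set ys)) xss"
    using Cons.IH[of "drop ?k xs"] Cons.prems(2) by auto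
  have "orthogonal_sets (set (take ?k xs)) (set (drop ?k xs))"
    unfolding orthogonal_sets_def
  proof (intro ballI)
    fix x y assume "x \<in> set (take ?k xs)" "y \<in> set (drop ?k xs)"
    then obtain i j where "i < ?k" "x = xs ! i" "j < dim_row ?E" "y = xs ! (?k + j)"
      using len by (auto simp: in_set_conv_nth)
    then show "x \<bullet> y = 0" using entry[of i "?k + j"] len by simp
  qed
  then have "sorted_wrt (\<lambda>xs ys. orthogonal_sets (set xs) (set ys)) (take ?k xs # xss)"
    using xss by (auto simp: orthogonal_sets_def)
  moreover have "take ?k xs \<noteq> []" using len Cons.prems(2) by auto
  moreover have "xs = concat (take ?k xs # xss)" using xss(1) append_take_drop_id[of ?k xs] by simp
  ultimately show ?case
    using xss(2,3) by (intro exI[of _ "take ?k xs # xss"]) auto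
qed

lemma gram_matrix_iff:
  assumes "set_mset D \<subseteq> carrier_vec n"
  shows "gram_matrix n D G \<longleftrightarrow> (\<exists>xs. mset xs = D \<and> G = gram_of xs)"
proof
  assume "gram_matrix n D G"
  then obtain S where S: "S \<in> carrier_mat n (size D)" "mset (cols S) = D" "G = S\<^sup>T * S"
    by (auto simp: gram_matrix_def matrix_representation_def)
  have "G = gram_of (cols S)"
    by (rule eq_matI) (use S in \<open>auto simp: gram_of_def\<close>)
  then show "\<exists>xs. mset xs = D \<and> G = gram_of xs" using S(2) by blast
next
  assume "\<exists>xs. mset xs = D \<and> G = gram_of xs"
  then obtain xs where xs: "mset xs = D" "G = gram_of xs" by blast
  have c: "set xs \<subseteq> carrier_vec n" using assms xs by auto
  let ?S = "mat_of_cols n xs"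
  have "G = ?S\<^sup>T * ?S"
    by (rule eq_matI) (use c in \<open>auto simp: xs(2) gram_of_def subset_iff\<close>)
  moreover have "matrix_representation n D ?S"
    using xs(1) c by (auto simp: matrix_representation_def)
  ultimately show "gram_matrix n D G" unfolding gram_matrix_def by blast
qed

lemma block_diagonal_gram_matrix_iff:
  assumes D: "set_mset D \<subseteq> carrier_vec n"
  shows "(\<exists>G. gram_matrix n D G \<and> block_diagonal s G) \<longleftrightarrow>
    (\<exists>F. D = (\<Sum>i<s. F i) \<and> (\<forall>i<s. F i \<noteq> {#}) \<and>
      (\<forall>i<s. \<forall>j<s. i \<noteq> j \<longrightarrow> orthogonal_sets (set_mset (F i)) (set_mset (F j))))"
    (is "?L \<longleftrightarrow> ?R")
proof
  let ?orth = "\<lambda>xs ys. orthogonal_sets (set xs) (set ys)"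
  have mset_concat_nth: "mset (concat xss) = (\<Sum>i<length xss. mset (xss ! i))" for xss :: "real vec list list"
    by (simp add: mset_concat sum_list_sum_nth atLeast0LessThan)
  {
    assume ?L
    then obtain xs Bs where "mset xs = D" "length Bs = s"
      "\<forall>B\<in>set Bs. square_mat B \<and> 0 < dim_row B" "gram_of xs = diag_block_mat Bs"
      using gram_matrix_iff[OF D] by (auto simp: block_diagonal_def)
    then obtain xss where xss: "mset (concat xss) = D" "length xss = s" "[] \<notin> set xss"
      "sorted_wrt ?orth xss"
      using gram_of_eq_diag_block_mat by metis
    have c: "set (xss ! i) \<subseteq> carrier_vec n" if "i < s" for i
    proof -
      have "set (xss ! i) \<subseteq> set (concat xss)" unfolding set_concat by (rule UN_upper) (use that xss(2) in simp)
      also have "\<dots> = set_mset D" using xss(1) by (metis set_mset_mset)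
      finally show ?thesis using D by simp
    qed
    \<comment> \<open>The list order gives orthogonality only for \<open>i < j\<close>; the rest is symmetry of the
      scalar product, which holds for vectors of equal dimension.\<close>
    have "?orth (xss ! i) (xss ! j)" if ij: "i < s" "j < s" "i \<noteq> j" for i j
    proof (cases "i < j")
      case True
      then show ?thesis using sorted_wrt_nth_less[OF xss(4)] ij xss(2) by auto
    next
      case False
      then have "?orth (xss ! j) (xss ! i)" using sorted_wrt_nth_less[OF xss(4)] ij xss(2) by auto
      then show ?thesis
        using c[OF ij(1)] c[OF ij(2)] comm_scalar_prod unfolding orthogonal_sets_def
        by (metis subsetD)
    qed
    moreover have "xss ! i \<noteq> []" if "i < s" for i using xss(2,3) that by (metis nth_mem)
    moreover have "D = (\<Sum>i<s. mset (xss ! i))" using xss(1,2) mset_concat_nth by metis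
    ultimately show ?R by (intro exI[of _ "\<lambda>i. mset (xss ! i)"]) auto
  next
    assume ?R
    then obtain F where F: "D = (\<Sum>i<s. F i)" "\<forall>i<s. F i \<noteq> {#}"
      "\<forall>i<s. \<forall>j<s. i \<noteq> j \<longrightarrow> orthogonal_sets (set_mset (F i)) (set_mset (F j))" by blast
    have "\<forall>i. \<exists>xs. mset xs = F i" using ex_mset by blast
    then obtain f where f: "\<And>i. mset (f i) = F i" by metis
    have fs: "set (f i) = set_mset (F i)" for i using f by (metis set_mset_mset)
    define xss where "xss = map f [0..<s]"
    have "mset (concat xss) = D" unfolding mset_concat_nth using F(1) by (simp add: xss_def f)
    moreover have "sorted_wrt ?orth xss"
      unfolding sorted_wrt_iff_nth_less using F(3) by (auto simp: xss_def fs)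
    moreover have "set (concat xss) \<subseteq> carrier_vec n"
      using D \<open>mset (concat xss) = D\<close> by (metis set_mset_mset)
    moreover have "\<forall>xs\<in>set xss. xs \<noteq> []"
    proof -
      have "f i \<noteq> []" if "i < s" for i using F(2) f[of i] that by auto
      then show ?thesis by (auto simp: xss_def)
    qed
    ultimately have "gram_matrix n D (gram_of (concat xss))"
      "gram_of (concat xss) = diag_block_mat (map gram_of xss)"
      using gram_of_concat[of xss n] by (auto simp: gram_matrix_iff[OF D])
    moreover have "block_diagonal s (diag_block_mat (map gram_of xss))"
      unfolding block_diagonal_def
      by (intro exI[of _ "map gram_of xss"])
        (use \<open>\<forall>xs\<in>set xss. xs \<noteq> []\<close> in \<open>auto simp: xss_def\<close>)
    ultimately show ?L by auto
  }
qed

section \<open>Orthogonally structured positive bases\<close>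

lemma size_sum: "size (\<Sum>i\<in>I. F i :: 'a multiset) = (\<Sum>i\<in>I. size (F i))"
  by (induction I rule: infinite_finite_induct) auto

text \<open>
  The sizes of the families sum to \<open>n + s\<close>, which is at most the sum of the lower bounds
  \<open>dim (L i) + 1\<close>. Termwise the sizes are at least these bounds, so they agree for every \<open>i\<close>,
  and each positive basis \<open>F i\<close> is minimal. The spans fill the space because they are the
  positive spans of the \<open>F i\<close>, whose sum is the positive span of \<open>D\<close>.
\<close>

lemma ospb_if_orthogonal_partition:
  assumes pb: "positive_basis n (carrier_vec n) D" and size_D: "size D = n + s"
    and D: "D = (\<Sum>i<s. F i)" and ne: "\<forall>i<s. F i \<noteq> {#}"
    and orth: "\<forall>i<s. \<forall>j<s. i \<noteq> j \<longrightarrow> orthogonal_sets (set_mset (F i)) (set_mset (F j))"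
  shows "ospb n s D"
proof -
  interpret vec_space "TYPE(real)" n .
  define L where "L i = span (set_mset (F i))" for i
  have Dc: "set_mset D \<subseteq> carrier_vec n" and pD: "pspan n D = carrier_vec n"
    using pb by (auto simp: positive_basis_def positive_spanning_set_def)
  have set_D: "set_mset D = (\<Union>i<s. set_mset (F i))" unfolding D by (simp add: set_mset_sum)
  have Fc: "set_mset (F i) \<subseteq> carrier_vec n" if "i < s" for i using Dc set_D that by auto
  have pbL: "positive_basis n (L i) (F i)" if i: "i < s" for i
  proof -
    have "D = F i + (\<Sum>j\<in>{..<s} - {i}. F j)"
      unfolding D using i by (simp add: sum.remove)
    moreover have "orthogonal_sets (set_mset (F i)) (set_mset (\<Sum>j\<in>{..<s} - {i}. F j))"
      using orth i by (simp add: orthogonal_sets_def set_mset_sum) blast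
    ultimately show ?thesis
      unfolding L_def using pb by (intro positive_basis_orthogonal_summand) simp_all
  qed
  then have pss: "positive_spanning_set n (L i) (F i)" if "i < s" for i
    using that by (simp add: positive_basis_def)
  have sub: "linear_subspace n (L i)" and pF: "pspan n (F i) = L i" if "i < s" for i
    using pss[OF that] by (auto simp: positive_spanning_set_def)
  have "span (\<Union>i<s. set_mset (F i)) = carrier_vec n"
    using pspan_subset_span[of n D] pD span_is_subset2[of "set_mset D"] Dc set_D by auto
  then have "n \<le> (\<Sum>i<s. subspace_dim n (L i))" using le_sum_subspace_dim[of s n L F] pss by blast
  then have "(\<Sum>i<s. size (F i)) \<le> (\<Sum>i<s. subspace_dim n (L i) + 1)"
    using size_D by (simp add: D size_sum sum_Suc)
  moreover have less: "subspace_dim n (L i) + 1 \<le> size (F i)" if "i < s" for i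
    using subspace_dim_less_size[OF pss[OF that]] ne that by simp
  then have "(\<Sum>i<s. subspace_dim n (L i) + 1) \<le> (\<Sum>i<s. size (F i))"
    by (intro sum_mono) simp
  ultimately have "(\<Sum>i<s. subspace_dim n (L i) + 1) = (\<Sum>i<s. size (F i))"
    by (rule antisym[rotated])
  then have size_F: "subspace_dim n (L i) + 1 = size (F i)" if "i < s" for i
    by (rule sum_mono_inv) (use that less in auto)
  have "minimal_positive_basis n (L i) (F i)" if "i < s" for i
    using pbL[OF that] size_F[OF that] subspace_dim_pos[OF pss[OF that]] ne that
    by (simp add: minimal_positive_basis_def)
  moreover have "\<forall>i<s. \<forall>j<s. i \<noteq> j \<longrightarrow> (\<forall>x\<in>L i. \<forall>y\<in>L j. x \<bullet> y = 0)"
  proof (intro allI impI)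
    fix i j assume ij: "i < s" "j < s" "i \<noteq> j"
    then have "orthogonal_sets (L i) (L j)"
      unfolding L_def by (intro orthogonal_span Fc) (use orth in auto)
    then show "\<forall>x\<in>L i. \<forall>y\<in>L j. x \<bullet> y = 0" by (simp add: orthogonal_sets_def)
  qed
  moreover have "carrier_vec n = {finsum_vec TYPE(real) n v {..<s} | v. \<forall>i<s. v i \<in> L i}"
  proof -
    have "pspan n (\<Sum>i<s. F i) = {finsum_vec TYPE(real) n v {..<s} | v. \<forall>i<s. v i \<in> pspan n (F i)}"
      by (rule pspan_sum) (use Fc in blast)
    moreover have "(\<forall>i<s. v i \<in> pspan n (F i)) \<longleftrightarrow> (\<forall>i<s. v i \<in> L i)" for v
      using pF by simp
    ultimately show ?thesis using pD D by simp
  qed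
  ultimately show ?thesis
    unfolding ospb_def using pb size_D D sub by blast
qed

theorem theorem3p1:
  fixes n s :: nat and D :: "real vec multiset"
  assumes "2 \<le> n" and "2 \<le> s"
    and "positive_basis n (carrier_vec n) D" and "size D = n + s"
  shows "ospb n s D \<longleftrightarrow> (\<exists>G. gram_matrix n D G \<and> block_diagonal s G)"
proof -
  have D: "set_mset D \<subseteq> carrier_vec n"
    using assms(3) by (simp add: positive_basis_def positive_spanning_set_def)
  show ?thesis
    unfolding block_diagonal_gram_matrix_iff[OF D]
  proof
    assume "ospb n s D"
    then obtain L F where "D = (\<Sum>i<s. F i)" "\<forall>i<s. minimal_positive_basis n (L i) (F i)"
      and "\<forall>i<s. \<forall>j<s. i \<noteq> j \<longrightarrow> (\<forall>x\<in>L i. \<forall>y\<in>L j. x \<bullet> y = 0)"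
      unfolding ospb_def by blast
    moreover from this(2) have "set_mset (F i) \<subseteq> L i" "F i \<noteq> {#}" if "i < s" for i
      using that unfolding minimal_positive_basis_def positive_basis_def positive_spanning_set_def
      by force+
    ultimately show "\<exists>F. D = (\<Sum>i<s. F i) \<and> (\<forall>i<s. F i \<noteq> {#}) \<and>
      (\<forall>i<s. \<forall>j<s. i \<noteq> j \<longrightarrow> orthogonal_sets (set_mset (F i)) (set_mset (F j)))"
      unfolding orthogonal_sets_def by (intro exI[of _ F]) blast
  next
    assume "\<exists>F. D = (\<Sum>i<s. F i) \<and> (\<forall>i<s. F i \<noteq> {#}) \<and>
      (\<forall>i<s. \<forall>j<s. i \<noteq> j \<longrightarrow> orthogonal_sets (set_mset (F i)) (set_mset (F j)))"
    then show "ospb n s D"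
      using ospb_if_orthogonal_partition[OF assms(3,4)] by blast
  qed
qed

end
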